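(* Let $X$ be a regular $T_1$ topological space. \begin{enumerate} \item[(1)] $X$ is nMCM if and only if it is MCM, if and only if it is a $\beta$-space. \item[(2)] Suppose that $X$ is either a $q$-space or a locally countably compact space. Then $X$ is nMCP if and only if it is MCP, if and only if it is a wN-space. In particular, if $X$ is nMCP and is either first countable or locally compact, then $X$ is MCP. \end{enumerate}
   Context: MCM and MCP: a space $X$ is MCM (monotonically countably metacompact) if there is an operator $U$ assigning to each $n\in\omega$ and each closed set $D\subseteq X$ an open set $U(n,D)$ such that: (i) $D\subseteq U(n,D)$; (ii) if $E\subseteq D$ are closed, then $U(n,E)\subseteq U(n,D)$; and (iii) if $(D_i)_{i\in\omega}$ is a decreasing sequence of closed sets with empty intersection, then $\bigcap_{n\in\omega}U(n,D_n)=\varnothing$. The space $X$ is MCP (monotonically countably paracompact) if there is such an operator $U$ which in addition satisfies: (iii$'$) if $(D_i)_{i\in\omega}$ is a decreasing sequence of closed sets with empty intersection, then $\bigcap_{n\in\omega}\overline{U(n,D_n)}=\varnothing$. nMCM and nMCP: a space $X$ is nMCM (nowhere dense MCM) if there is an operator $U$ assigning an open set $U(n,D)$ to each $n\in\omega$ and each closed, nowhere dense set $D\subseteq X$ such that: (i) $D\subseteq U(n,D)$; (ii) if $E\subseteq D$ are closed and nowhere dense, then $U(n,E)\subseteq U(n,D)$; and (iii) if $(D_n)_{n\in\omega}$ is a decreasing sequence of closed, nowhere dense sets with empty intersection, then $\bigcap_{n\in\omega}U(n,D_n)=\varnothing$. The space $X$ is nMCP if there is such an operator $U$ which in addition satisfies: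 (iii$'$) if $(D_n)_{n\in\omega}$ is a decreasing sequence of closed, nowhere dense sets with empty intersection, then $\bigcap_{n\in\omega}\overline{U(n,D_n)}=\varnothing$. $\beta$-, wN- and $q$-spaces: a space $X$ is a $\beta$-space (respectively wN-space, $q$-space) if one can assign to each $x\in X$ and $n\in\omega$ an open set $g(n,x)$ containing $x$ such that the corresponding condition holds, for every point $x\in X$ and every sequence $(y_n)_{n\in\omega}$ of points of $X$: ($\beta$) if $x\in g(n,y_n)$ for all $n$, then the sequence $(y_n)$ has a cluster point; (wN) if $g(n,x)\cap g(n,y_n)\neq\varnothing$ for all $n$, then the sequence $(y_n)$ has a cluster point; (q) if $y_n\in g(n,x)$ for all $n$, then the sequence $(y_n)$ has a cluster point. A space is locally countably compact if every point has a neighbourhood with countably compact closure. *)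

theory Defs
  imports "HOL-Analysis.Analysis"
begin

definition nowhere_dense_in :: "'a topology \<Rightarrow> 'a set \<Rightarrow> bool" where
  "nowhere_dense_in X S \<longleftrightarrow> S \<subseteq> topspace X \<and> X interior_of (X closure_of S) = {}"

(* The family \<D> is the domain of the operator: all closed sets for MCM and MCP, and all closed
   nowhere dense sets for nMCM and nMCP. Values of U outside \<D> are irrelevant. *)
definition monotone_open_expansion ::
    "'a topology \<Rightarrow> 'a set set \<Rightarrow> (nat \<Rightarrow> 'a set \<Rightarrow> 'a set) \<Rightarrow> bool" where
  "monotone_open_expansion X \<D> U \<longleftrightarrow>
     (\<forall>n. \<forall>D\<in>\<D>. openin X (U n D) \<and> D \<subseteq> U n D) \<and>
     (\<forall>n. \<forall>D\<in>\<D>. \<forall>E\<in>\<D>. E \<subseteq> D \<longrightarrow> U n E \<subseteq> U n D) \<and>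
     (\<forall>D. range D \<subseteq> \<D> \<and> decseq D \<and> (\<Inter>n. D n) = {} \<longrightarrow> (\<Inter>n. U n (D n)) = {})"

definition closure_expansion ::
    "'a topology \<Rightarrow> 'a set set \<Rightarrow> (nat \<Rightarrow> 'a set \<Rightarrow> 'a set) \<Rightarrow> bool" where
  "closure_expansion X \<D> U \<longleftrightarrow>
     (\<forall>D. range D \<subseteq> \<D> \<and> decseq D \<and> (\<Inter>n. D n) = {} \<longrightarrow>
        (\<Inter>n. X closure_of (U n (D n))) = {})"

definition MCM_space :: "'a topology \<Rightarrow> bool" where
  "MCM_space X \<longleftrightarrow> (\<exists>U. monotone_open_expansion X {D. closedin X D} U)"

definition MCP_space :: "'a topology \<Rightarrow> bool" where
  "MCP_space X \<longleftrightarrow>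
     (\<exists>U. monotone_open_expansion X {D. closedin X D} U \<and>
          closure_expansion X {D. closedin X D} U)"

definition nMCM_space :: "'a topology \<Rightarrow> bool" where
  "nMCM_space X \<longleftrightarrow>
     (\<exists>U. monotone_open_expansion X {D. closedin X D \<and> nowhere_dense_in X D} U)"

definition nMCP_space :: "'a topology \<Rightarrow> bool" where
  "nMCP_space X \<longleftrightarrow>
     (\<exists>U. monotone_open_expansion X {D. closedin X D \<and> nowhere_dense_in X D} U \<and>
          closure_expansion X {D. closedin X D \<and> nowhere_dense_in X D} U)"

definition cluster_point_of_seq :: "'a topology \<Rightarrow> (nat \<Rightarrow> 'a) \<Rightarrow> 'a \<Rightarrow> bool" where
  "cluster_point_of_seq X y z \<longleftrightarrow>
     z \<in> topspace X \<and>
     (\<forall>V. openin X V \<and> z \<in> V \<longrightarrow> (\<exists>\<^sub>F n in sequentially. y n \<in> V))"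

definition open_nhd_assignment :: "'a topology \<Rightarrow> (nat \<Rightarrow> 'a \<Rightarrow> 'a set) \<Rightarrow> bool" where
  "open_nhd_assignment X g \<longleftrightarrow> (\<forall>n. \<forall>x\<in>topspace X. openin X (g n x) \<and> x \<in> g n x)"

definition beta_space :: "'a topology \<Rightarrow> bool" where
  "beta_space X \<longleftrightarrow>
     (\<exists>g. open_nhd_assignment X g \<and>
       (\<forall>x\<in>topspace X. \<forall>y. range y \<subseteq> topspace X \<and> (\<forall>n. x \<in> g n (y n)) \<longrightarrow>
          (\<exists>z. cluster_point_of_seq X y z)))"

definition wN_space :: "'a topology \<Rightarrow> bool" where
  "wN_space X \<longleftrightarrow>
     (\<exists>g. open_nhd_assignment X g \<and>
       (\<forall>x\<in>topspace X. \<forall>y. range y \<subseteq> topspace X \<and> (\<forall>n. g n x \<inter> g n (y n) \<noteq> {}) \<longrightarrow>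
          (\<exists>z. cluster_point_of_seq X y z)))"

definition q_space :: "'a topology \<Rightarrow> bool" where
  "q_space X \<longleftrightarrow>
     (\<exists>g. open_nhd_assignment X g \<and>
       (\<forall>x\<in>topspace X. \<forall>y. range y \<subseteq> topspace X \<and> (\<forall>n. y n \<in> g n x) \<longrightarrow>
          (\<exists>z. cluster_point_of_seq X y z)))"

definition countably_compactin :: "'a topology \<Rightarrow> 'a set \<Rightarrow> bool" where
  "countably_compactin X S \<longleftrightarrow>
     S \<subseteq> topspace X \<and>
     (\<forall>\<U>. countable \<U> \<and> (\<forall>U\<in>\<U>. openin X U) \<and> S \<subseteq> \<Union>\<U> \<longrightarrow>
        (\<exists>\<F>. finite \<F> \<and> \<F> \<subseteq> \<U> \<and> S \<subseteq> \<Union>\<F>))"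

definition locally_countably_compact_space :: "'a topology \<Rightarrow> bool" where
  "locally_countably_compact_space X \<longleftrightarrow>
     (\<forall>x\<in>topspace X. \<exists>N\<subseteq>topspace X.
        x \<in> X interior_of N \<and> countably_compactin X (X closure_of N))"

end

theory Submission
  imports Defs
begin

text \<open>
  Singletons of non-isolated points are closed and nowhere dense, so an nMCM operator \<open>U\<close> yields the
  neighbourhoods \<open>g n x = (\<Inter>i\<le>n. U i {x})\<close> at these points; at an isolated point take \<open>g n x = {x}\<close>.
  Every sequence has a subsequence consisting only of isolated or only of non-isolated points.
  In the first case the condition on \<open>g\<close> controls the sequence directly. In the second case, if there
  were no cluster point, the closures of the tails would be closed nowhere dense sets
  decreasing to the empty set, and evaluating \<open>U\<close> on them gives a contradiction. The q-property
  supplies a cluster point of the points \<open>z\<^sub>n\<close> in \<open>g n x \<inter> g n (y\<^sub>n)\<close>, which lies in the closures of the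
  sets \<open>U n\<close> of the tails. Conversely, \<open>U n D = (\<Union>y\<in>D. g n y)\<close> turns neighbourhood assignments
  into operators. Local countable compactness and first countability each imply the q-property.
\<close>

section \<open>Operators on closed sets and their restrictions to nowhere dense sets\<close>

lemma monotone_open_expansion_subset:
  assumes "monotone_open_expansion X \<D> U" and "\<E> \<subseteq> \<D>"
  shows "monotone_open_expansion X \<E> U"
  using assms unfolding monotone_open_expansion_def by (meson order_trans subsetD)

lemma closure_expansion_subset:
  assumes "closure_expansion X \<D> U" and "\<E> \<subseteq> \<D>"
  shows "closure_expansion X \<E> U"
  using assms unfolding closure_expansion_def by (meson order_trans)

lemma monotone_open_expansion_INT_empty:
  assumes "monotone_open_expansion X \<D> U"
    and "range D \<subseteq> \<D> \<and> decseq D \<and> (\<Inter>n. D n) = {}"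
  shows "(\<Inter>n. U n (D n)) = {}"
  using assms unfolding monotone_open_expansion_def by meson

lemma closure_expansion_INT_empty:
  assumes "closure_expansion X \<D> U"
    and "range D \<subseteq> \<D> \<and> decseq D \<and> (\<Inter>n. D n) = {}"
  shows "(\<Inter>n. X closure_of (U n (D n))) = {}"
  using assms unfolding closure_expansion_def by meson

lemma MCM_imp_nMCM:
  assumes "MCM_space X"
  shows "nMCM_space X"
proof -
  have "{D. closedin X D \<and> nowhere_dense_in X D} \<subseteq> {D. closedin X D}"
    by blast
  with assms show ?thesis
    unfolding MCM_space_def nMCM_space_def
    by (meson monotone_open_expansion_subset)
qed

lemma MCP_imp_nMCP:
  assumes "MCP_space X"
  shows "nMCP_space X"
proof -
  have "{D. closedin X D \<and> nowhere_dense_in X D} \<subseteq> {D. closedin X D}"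
    by blast
  with assms show ?thesis
    unfolding MCP_space_def nMCP_space_def
    by (meson monotone_open_expansion_subset closure_expansion_subset)
qed

section \<open>Cluster points and closures of tails of sequences\<close>

lemma cluster_point_of_seq_iff_closure_of_tails:
  "cluster_point_of_seq X y z \<longleftrightarrow> (\<forall>n. z \<in> X closure_of (y ` {n..}))"
  unfolding cluster_point_of_seq_def in_closure_of frequently_sequentially by auto

text \<open>The map \<open>e\<close> need be neither increasing nor injective:
  \<open>n \<le> e n\<close> alone turns arbitrarily late visits to an open set by the reindexed
  sequence into arbitrarily late visits by \<open>y\<close>.\<close>

lemma cluster_point_of_seq_reindex:
  assumes "cluster_point_of_seq X (\<lambda>n. y (e n)) z" and "\<And>n. n \<le> e n"
  shows "cluster_point_of_seq X y z"
  using assms unfolding cluster_point_of_seq_def frequently_sequentially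
  by (meson order_trans)

lemma cluster_point_of_seq_const:
  "x \<in> topspace X \<Longrightarrow> cluster_point_of_seq X (\<lambda>n. x) x"
  unfolding cluster_point_of_seq_def frequently_sequentially by blast

lemma homogeneous_reindexing:
  fixes P :: "nat \<Rightarrow> bool"
  obtains e where "\<And>n. n \<le> e n" "(\<forall>n. P (e n)) \<or> (\<forall>n. \<not> P (e n))"
proof (cases "\<forall>n. \<exists>m\<ge>n. P m")
  case True
  then show ?thesis using that by metis
next
  case False
  then obtain N where N: "\<And>m. N \<le> m \<Longrightarrow> \<not> P m"
    by blast
  show ?thesis
    \<comment> \<open>Beyond \<open>N\<close> the property fails throughout; \<open>max\<close>
      keeps the index both at least \<open>n\<close> and beyond \<open>N\<close>.\<close>
    by (rule that[of "\<lambda>n. max n N"]) (simp_all add: N)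
qed

lemma nowhere_dense_in_singleton:
  assumes "t1_space X" and "x \<in> topspace X" and "\<not> openin X {x}"
  shows "nowhere_dense_in X {x}"
proof -
  have "X closure_of {x} = {x}"
    using assms by (simp add: closure_of_closedin t1_space_closedin_singleton)
  moreover have "X interior_of {x} = {}"
    using interior_of_subset[of X "{x}"] openin_interior_of[of X "{x}"] assms(3)
    by (metis subset_singletonD)
  ultimately show ?thesis
    using assms(2) by (simp add: nowhere_dense_in_def)
qed

text \<open>A nonempty interior of the closure would contain a term \<open>y i\<close>. Since
  \<open>y i\<close> is not a cluster point, some neighbourhood of it meets the sequence in finitely
  many points only; shrinking it in a T1 space leaves \<open>{y i}\<close> open, against the
  assumption that no term is isolated.\<close>

lemma nowhere_dense_in_closure_of_tail:
  assumes "t1_space X" and y: "range y \<subseteq> topspace X" and iso: "\<And>n. \<not> openin X {y n}"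
    and no: "\<nexists>z. cluster_point_of_seq X y z"
  shows "nowhere_dense_in X (X closure_of (y ` {n..}))"
proof -
  have "X interior_of (X closure_of (y ` {n..})) = {}" (is "?W = {}")
  proof (rule ccontr)
    assume "?W \<noteq> {}"
    then obtain p where "p \<in> ?W" by blast
    then have "p \<in> X closure_of (y ` {n..})"
      by (rule subsetD[OF interior_of_subset])
    then have "\<exists>q\<in>y ` {n..}. q \<in> ?W"
      using \<open>p \<in> ?W\<close> openin_interior_of[of X "X closure_of (y ` {n..})"]
      unfolding in_closure_of[of p] by blast
    then obtain i where i: "y i \<in> ?W" by auto
    have "y i \<in> topspace X" "\<not> cluster_point_of_seq X y (y i)"
      using no y by blast+
    then obtain V N where V: "openin X V" "y i \<in> V" "\<And>m. N \<le> m \<Longrightarrow> y m \<notin> V"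
      unfolding cluster_point_of_seq_def frequently_sequentially by meson
    \<comment> \<open>Terms from index \<open>N\<close> on avoid \<open>V\<close>, so after removing
      \<open>?F\<close> the only value of the sequence left in \<open>V\<close> is
      \<open>y i\<close>.\<close>
    let ?F = "y ` {..<N} - {y i}"
    have "closedin X ?F"
      using assms(1) y by (intro t1_space_closedin_finite[THEN iffD1, rule_format]) auto
    then have open_S: "openin X (?W \<inter> V - ?F)"
      using V(1) by (simp add: openin_Int openin_diff)
    \<comment> \<open>A second point \<open>q\<close> would lie in the closure of the tail and have
      a neighbourhood without any term.\<close>
    have "q = y i" if q: "q \<in> ?W \<inter> V - ?F" for q
    proof (rule ccontr)
      assume "q \<noteq> y i"
      then have "openin X (?W \<inter> V - ?F - {y i})" "q \<in> ?W \<inter> V - ?F - {y i}"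
        using open_S q assms(1) \<open>y i \<in> topspace X\<close>
        by (simp_all add: openin_diff t1_space_closedin_singleton)
      moreover have "q \<in> X closure_of (y ` {n..})"
        using q interior_of_subset[of X "X closure_of (y ` {n..})"] by (meson DiffD1 IntD1 subsetD)
      ultimately obtain j where "y j \<in> ?W \<inter> V - ?F - {y i}"
        unfolding in_closure_of[of q] by (metis (no_types, lifting) imageE)
      then show False using V(3) not_le by blast
    qed
    then have "?W \<inter> V - ?F = {y i}"
      using i V(2) by blast
    then show False using open_S iso by metis
  qed
  then show ?thesis
    by (simp add: nowhere_dense_in_def closure_of_subset_topspace)
qed

lemma cluster_point_of_seq_in_decseq:
  assumes "\<And>n. closedin X (D n)" and "decseq D" and "\<And>n. y n \<in> D n"
    and "cluster_point_of_seq X y z"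
  shows "z \<in> D n"
proof -
  have "y ` {n..} \<subseteq> D n"
    using assms(2,3) by (auto simp: decseq_def)
  then have "X closure_of (y ` {n..}) \<subseteq> D n"
    using assms(1) by (simp add: closure_of_minimal)
  moreover have "z \<in> X closure_of (y ` {n..})"
    using assms(4) by (simp add: cluster_point_of_seq_iff_closure_of_tails)
  ultimately show ?thesis by (rule subsetD)
qed

section \<open>From neighbourhood assignments to operators\<close>

lemma open_nhd_assignment_Union:
  assumes "open_nhd_assignment X g" and "closedin X D"
  shows "openin X (\<Union>y\<in>D. g n y)" and "D \<subseteq> (\<Union>y\<in>D. g n y)"
  using assms(1) closedin_subset[OF assms(2)] unfolding open_nhd_assignment_def
  by (blast intro: openin_Union)+

lemma monotone_open_expansion_Union:
  assumes g: "open_nhd_assignment X g"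
    and "\<And>D. \<lbrakk>\<And>n. closedin X (D n); decseq D; (\<Inter>n. D n) = {}\<rbrakk>
      \<Longrightarrow> (\<Inter>n. \<Union>y\<in>D n. g n y) = {}"
  shows "monotone_open_expansion X {D. closedin X D} (\<lambda>n D. \<Union>y\<in>D. g n y)"
  unfolding monotone_open_expansion_def
proof (intro conjI allI ballI impI; (elim conjE)?)
  fix n D assume "D \<in> {D. closedin X D}"
  then show "openin X (\<Union>y\<in>D. g n y)" "D \<subseteq> (\<Union>y\<in>D. g n y)"
    using open_nhd_assignment_Union[OF g] by simp_all
next
  fix n and D E :: "'a set" assume "E \<subseteq> D"
  then show "(\<Union>y\<in>E. g n y) \<subseteq> (\<Union>y\<in>D. g n y)" by (rule UN_mono) simp
next
  fix D assume "range D \<subseteq> {D. closedin X D}" "decseq D" "(\<Inter>n. D n) = {}"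
  then show "(\<Inter>n. \<Union>y\<in>D n. g n y) = {}"
    by (intro assms(2)) auto
qed

text \<open>A point \<open>x\<close> in all the unions selects \<open>y n\<close> in
  \<open>D n\<close> with \<open>x\<close> in \<open>g n (y n)\<close>. A cluster point of
  \<open>y\<close> then belongs to every \<open>D n\<close>, so the intersection of the
  \<open>D n\<close> is not empty.\<close>

lemma beta_imp_MCM:
  assumes "beta_space X"
  shows "MCM_space X"
proof -
  obtain g where g: "open_nhd_assignment X g"
    and beta: "\<And>x y. \<lbrakk>x \<in> topspace X; range y \<subseteq> topspace X; \<And>n. x \<in> g n (y n)\<rbrakk>
      \<Longrightarrow> \<exists>z. cluster_point_of_seq X y z"
    using assms unfolding beta_space_def by blast
  have "(\<Inter>n. \<Union>y\<in>D n. g n y) = {}"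
    if D: "\<And>n. closedin X (D n)" "decseq D" "(\<Inter>n. D n) = {}" for D
  proof (rule ccontr)
    assume "(\<Inter>n. \<Union>y\<in>D n. g n y) \<noteq> {}"
    then obtain x where "x \<in> (\<Inter>n. \<Union>y\<in>D n. g n y)" by (meson ex_in_conv)
    then have "\<forall>n. \<exists>y\<in>D n. x \<in> g n y" by simp
    then obtain y where y: "\<And>n. y n \<in> D n" "\<And>n. x \<in> g n (y n)" by metis
    have ytop: "range y \<subseteq> topspace X"
      using y(1) D(1) closedin_subset by blast
    then have "x \<in> topspace X"
      using y(2)[of 0] g openin_subset unfolding open_nhd_assignment_def by blast
    then obtain z where "cluster_point_of_seq X y z"
      using beta ytop y(2) by blast
    then show False
      using cluster_point_of_seq_in_decseq[OF D(1,2) y(1)] D(3) by blast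
  qed
  then show ?thesis
    using monotone_open_expansion_Union[OF g] unfolding MCM_space_def by blast
qed

lemma wN_imp_MCP:
  assumes "wN_space X"
  shows "MCP_space X"
proof -
  obtain g where g: "open_nhd_assignment X g"
    and wN: "\<And>x y. \<lbrakk>x \<in> topspace X; range y \<subseteq> topspace X; \<And>n. g n x \<inter> g n (y n) \<noteq> {}\<rbrakk>
      \<Longrightarrow> \<exists>z. cluster_point_of_seq X y z"
    using assms unfolding wN_space_def by metis
  have cl: "(\<Inter>n. X closure_of (\<Union>y\<in>D n. g n y)) = {}"
    if D: "\<And>n. closedin X (D n)" "decseq D" "(\<Inter>n. D n) = {}" for D
  proof (rule ccontr)
    assume "(\<Inter>n. X closure_of (\<Union>y\<in>D n. g n y)) \<noteq> {}"
    then obtain x where "x \<in> (\<Inter>n. X closure_of (\<Union>y\<in>D n. g n y))" by (meson ex_in_conv)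
    then have x: "x \<in> X closure_of (\<Union>y\<in>D n. g n y)" for n by simp
    then have xtop: "x \<in> topspace X" by (simp add: in_closure_of)
    \<comment> \<open>Testing membership in the closure with the neighbourhood \<open>g n x\<close>
      of \<open>x\<close> produces precisely the hypothesis of the wN condition.\<close>
    have "\<exists>y\<in>D n. g n x \<inter> g n y \<noteq> {}" for n
    proof -
      have "openin X (g n x)" "x \<in> g n x"
        using g xtop unfolding open_nhd_assignment_def by blast+
      then obtain w where "w \<in> (\<Union>y\<in>D n. g n y)" "w \<in> g n x"
        using x[of n] unfolding in_closure_of by blast
      then show ?thesis by blast
    qed
    then obtain y where y: "\<And>n. y n \<in> D n" "\<And>n. g n x \<inter> g n (y n) \<noteq> {}" by metis
    have ytop: "range y \<subseteq> topspace X"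
      using y(1) D(1) closedin_subset by blast
    then obtain z where "cluster_point_of_seq X y z"
      using wN xtop y(2) by blast
    then show False
      using cluster_point_of_seq_in_decseq[OF D(1,2) y(1)] D(3) by blast
  qed
  \<comment> \<open>The condition without closures follows from \<open>cl\<close>, as each union is
    contained in its closure.\<close>
  have "(\<Inter>n. \<Union>y\<in>D n. g n y) = {}"
    if D: "\<And>n. closedin X (D n)" "decseq D" "(\<Inter>n. D n) = {}" for D
  proof -
    have "(\<Union>y\<in>D n. g n y) \<subseteq> X closure_of (\<Union>y\<in>D n. g n y)" for n
      using open_nhd_assignment_Union(1)[OF g D(1)] by (simp add: closure_of_subset openin_subset)
    then have "(\<Inter>n. \<Union>y\<in>D n. g n y) \<subseteq> (\<Inter>n. X closure_of (\<Union>y\<in>D n. g n y))"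
      by (rule INF_mono')
    then show ?thesis using cl[OF D] by simp
  qed
  then have "monotone_open_expansion X {D. closedin X D} (\<lambda>n D. \<Union>y\<in>D. g n y)"
    by (rule monotone_open_expansion_Union[OF g])
  moreover have "closure_expansion X {D. closedin X D} (\<lambda>n D. \<Union>y\<in>D. g n y)"
    using cl unfolding closure_expansion_def by (auto simp: image_subset_iff)
  ultimately show ?thesis unfolding MCP_space_def by blast
qed

section \<open>From operators on nowhere dense sets to neighbourhood assignments\<close>

text \<open>An open singleton is not nowhere dense, so the operator says nothing at isolated points;
  there the least neighbourhood is chosen. Elsewhere the finite intersections force the assignment
  to decrease in \<open>n\<close>, which is what permits replacing an index \<open>e n\<close> by a
  smaller one.\<close>

definition isolated_modification ::
    "'a topology \<Rightarrow> (nat \<Rightarrow> 'a \<Rightarrow> 'a set) \<Rightarrow> nat \<Rightarrow> 'a \<Rightarrow> 'a set" where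
  "isolated_modification X h n x = (if openin X {x} then {x} else \<Inter>i\<le>n. h i x)"

lemma open_nhd_assignment_isolated_modification:
  assumes "\<And>n x. \<lbrakk>x \<in> topspace X; \<not> openin X {x}\<rbrakk> \<Longrightarrow> openin X (h n x) \<and> x \<in> h n x"
  shows "open_nhd_assignment X (isolated_modification X h)"
  using assms unfolding open_nhd_assignment_def isolated_modification_def
  by (auto intro!: openin_INT2)

lemma isolated_modification_antimono:
  "m \<le> n \<Longrightarrow> isolated_modification X h n x \<subseteq> isolated_modification X h m x"
  unfolding isolated_modification_def by (auto intro: order_trans)

lemma isolated_modification_subset:
  "\<not> openin X {x} \<Longrightarrow> m \<le> n \<Longrightarrow> isolated_modification X h n x \<subseteq> h m x"
  unfolding isolated_modification_def by auto

lemma monotone_open_expansion_singleton_nhd: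
  assumes "monotone_open_expansion X {D. closedin X D \<and> nowhere_dense_in X D} U"
    and "t1_space X" and "x \<in> topspace X" and "\<not> openin X {x}"
  shows "openin X (U n {x}) \<and> x \<in> U n {x}"
proof -
  have "{x} \<in> {D. closedin X D \<and> nowhere_dense_in X D}"
    using assms nowhere_dense_in_singleton by (auto simp: t1_space_closedin_singleton)
  then show ?thesis
    using assms(1) unfolding monotone_open_expansion_def by (meson insert_subset)
qed

text \<open>The absence of cluster points is used twice: it makes the closures of the tails nowhere
  dense and their intersection empty. Hence the conditions on \<open>U\<close> for decreasing
  sequences apply to them.\<close>

lemma tails_family:
  assumes "t1_space X" and "range y \<subseteq> topspace X" and "\<And>n. \<not> openin X {y n}"
    and "\<nexists>z. cluster_point_of_seq X y z"
  defines "D \<equiv> \<lambda>n. X closure_of (y ` {n..})"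
  shows "range D \<subseteq> {D. closedin X D \<and> nowhere_dense_in X D} \<and> decseq D \<and> (\<Inter>n. D n) = {}"
proof (intro conjI)
  show "range D \<subseteq> {D. closedin X D \<and> nowhere_dense_in X D}"
    using nowhere_dense_in_closure_of_tail[OF assms(1-4)] by (auto simp: D_def)
  show "decseq D"
    unfolding decseq_def D_def by (auto intro!: closure_of_mono image_mono)
  show "(\<Inter>n. D n) = {}"
    using assms(4) unfolding D_def cluster_point_of_seq_iff_closure_of_tails by blast
qed

text \<open>This is monotonicity of \<open>U n\<close> for \<open>{y i}\<close> inside the closure
  of the tail, both being closed and nowhere dense. It transfers information from neighbourhoods of
  points to the sets \<open>U n\<close> of the tails.\<close>

lemma singleton_expansion_subset_tail:
  assumes U: "monotone_open_expansion X {D. closedin X D \<and> nowhere_dense_in X D} U"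
    and X: "t1_space X" and y: "range y \<subseteq> topspace X" and iso: "\<And>n. \<not> openin X {y n}"
    and no: "\<nexists>z. cluster_point_of_seq X y z" and "n \<le> i"
  shows "U n {y i} \<subseteq> U n (X closure_of (y ` {n..}))"
proof -
  have "y i \<in> topspace X" using y by blast
  then have "closedin X {y i}" "nowhere_dense_in X {y i}"
    using nowhere_dense_in_singleton[OF X _ iso] X by (auto simp: t1_space_closedin_singleton)
  moreover have "y i \<in> X closure_of (y ` {n..})"
    using closure_of_subset[of "y ` {n..}" X] y \<open>n \<le> i\<close> by (auto simp: image_subset_iff)
  moreover have "nowhere_dense_in X (X closure_of (y ` {n..}))"
    using nowhere_dense_in_closure_of_tail[OF X y iso no] .
  ultimately show ?thesis
    using U unfolding monotone_open_expansion_def by simp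
qed

lemma nMCM_imp_beta:
  assumes X: "t1_space X" and "nMCM_space X"
  shows "beta_space X"
proof -
  obtain U where U: "monotone_open_expansion X {D. closedin X D \<and> nowhere_dense_in X D} U"
    using assms(2) unfolding nMCM_space_def by blast
  define g where "g = isolated_modification X (\<lambda>n x. U n {x})"
  have "open_nhd_assignment X g"
    unfolding g_def using monotone_open_expansion_singleton_nhd[OF U X]
    by (rule open_nhd_assignment_isolated_modification)
  moreover have "\<exists>z. cluster_point_of_seq X y z"
    if x: "x \<in> topspace X" and y: "range y \<subseteq> topspace X" and xg: "\<And>n. x \<in> g n (y n)" for x y
  proof -
    obtain e where e: "\<And>n. n \<le> e n"
      and hom: "(\<forall>n. openin X {y (e n)}) \<or> (\<forall>n. \<not> openin X {y (e n)})"
      using homogeneous_reindexing[of "\<lambda>n. openin X {y n}"] by blast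
    have "\<exists>z. cluster_point_of_seq X (\<lambda>n. y (e n)) z"
      using hom
    proof
      assume "\<forall>n. openin X {y (e n)}"
      \<comment> \<open>At an isolated point the assigned set is a singleton, and it contains
        \<open>x\<close>.\<close>
      then have "(\<lambda>n. y (e n)) = (\<lambda>n. x)"
        using xg unfolding g_def isolated_modification_def by (metis singletonD)
      then show ?thesis using cluster_point_of_seq_const[OF x] by metis
    next
      assume iso: "\<forall>n. \<not> openin X {y (e n)}"
      show ?thesis
      proof (rule ccontr)
        assume no: "\<nexists>z. cluster_point_of_seq X (\<lambda>n. y (e n)) z"
        have ye: "range (\<lambda>n. y (e n)) \<subseteq> topspace X" using y by blast
        \<comment> \<open>Membership is known at level \<open>e n\<close>; since
          \<open>n \<le> e n\<close>, the finite intersection includes the factor with index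
          \<open>n\<close>.\<close>
        have "x \<in> U n {y (e n)}" for n
          using xg[of "e n"] isolated_modification_subset[OF iso[rule_format] e]
          unfolding g_def by (rule subsetD[rotated])
        then have "x \<in> U n (X closure_of ((\<lambda>n. y (e n)) ` {n..}))" for n
          using singleton_expansion_subset_tail[OF U X ye iso[rule_format] no order_refl] by blast
        then have "x \<in> (\<Inter>n. U n (X closure_of ((\<lambda>n. y (e n)) ` {n..})))" by simp
        then show False
          using monotone_open_expansion_INT_empty[OF U tails_family[OF X ye iso[rule_format] no]]
          by (metis empty_iff)
      qed
    qed
    then show ?thesis using cluster_point_of_seq_reindex e by metis
  qed
  ultimately show ?thesis unfolding beta_space_def by blast
qed

text \<open>Unlike in the beta condition, no fixed point lies in all the sets assigned to the
  \<open>y n\<close>. Intersecting with the q-assignment \<open>h\<close> gives the varying common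
  points a cluster point \<open>z\<close>, which takes over the role of \<open>x\<close> once
  closures are allowed.\<close>

lemma nMCP_q_imp_wN:
  assumes X: "t1_space X" and "nMCP_space X" and "q_space X"
  shows "wN_space X"
proof -
  obtain U where U: "monotone_open_expansion X {D. closedin X D \<and> nowhere_dense_in X D} U"
    and clU: "closure_expansion X {D. closedin X D \<and> nowhere_dense_in X D} U"
    using assms(2) unfolding nMCP_space_def by blast
  obtain h where h: "open_nhd_assignment X h"
    and q: "\<And>x y. \<lbrakk>x \<in> topspace X; range y \<subseteq> topspace X; \<And>n. y n \<in> h n x\<rbrakk>
      \<Longrightarrow> \<exists>z. cluster_point_of_seq X y z"
    using assms(3) unfolding q_space_def by blast
  define g where "g = isolated_modification X (\<lambda>n x. U n {x} \<inter> h n x)"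
  have g: "open_nhd_assignment X g"
    unfolding g_def using monotone_open_expansion_singleton_nhd[OF U X] h
    by (intro open_nhd_assignment_isolated_modification)
       (auto simp: open_nhd_assignment_def intro: openin_Int)
  have g_h: "g n x \<subseteq> h n x" if "x \<in> topspace X" for n x
    using that h isolated_modification_subset[of X x n n]
    \<comment> \<open>At an isolated \<open>x\<close> the inclusion only says that \<open>x\<close>
      lies in \<open>h n x\<close>.\<close>
    unfolding g_def open_nhd_assignment_def
    by (cases "openin X {x}") (auto simp: isolated_modification_def)
  have "\<exists>z. cluster_point_of_seq X y z"
    if x: "x \<in> topspace X" and y: "range y \<subseteq> topspace X"
      and meet: "\<And>n. g n x \<inter> g n (y n) \<noteq> {}" for x y
  proof -
    obtain e where e: "\<And>n. n \<le> e n"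
      and hom: "(\<forall>n. openin X {y (e n)}) \<or> (\<forall>n. \<not> openin X {y (e n)})"
      using homogeneous_reindexing[of "\<lambda>n. openin X {y n}"] by blast
    have "\<forall>n. \<exists>u. u \<in> g (e n) x \<and> u \<in> g (e n) (y (e n))"
      using meet by (simp add: disjoint_iff)
    then obtain w where w: "\<And>n. w n \<in> g (e n) x" "\<And>n. w n \<in> g (e n) (y (e n))"
      by metis
    have wh: "w n \<in> h n x" for n
      using w(1)[of n] isolated_modification_antimono[OF e[of n]] g_h[OF x, of n]
      unfolding g_def by (meson subsetD)
    have wtop: "range w \<subseteq> topspace X"
      using w(1) g x openin_subset unfolding open_nhd_assignment_def by blast
    obtain z where z: "cluster_point_of_seq X w z"
      using q[OF x wtop wh] by blast
    have "\<exists>z. cluster_point_of_seq X (\<lambda>n. y (e n)) z"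
      using hom
    proof
      assume "\<forall>n. openin X {y (e n)}"
      \<comment> \<open>Here \<open>w n\<close> is a member of the singleton
        \<open>{y (e n)}\<close>, so \<open>z\<close> is already the required cluster point.\<close>
      then have "w n = y (e n)" for n
        using w(2)[of n] by (simp add: g_def isolated_modification_def)
      then have "w = (\<lambda>n. y (e n))" by (rule ext)
      then show ?thesis using z by metis
    next
      assume iso: "\<forall>n. \<not> openin X {y (e n)}"
      show ?thesis
      proof (rule ccontr)
        assume no: "\<nexists>z. cluster_point_of_seq X (\<lambda>n. y (e n)) z"
        have ye: "range (\<lambda>n. y (e n)) \<subseteq> topspace X" using y by blast
        \<comment> \<open>A whole tail of \<open>w\<close> must lie in the set for each fixed
          \<open>n\<close>, since a cluster point depends only on tails; hence two indices.\<close>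
        have "w i \<in> U n (X closure_of ((\<lambda>n. y (e n)) ` {n..}))" if "n \<le> i" for n i
        proof -
          have "n \<le> e i" using that e order_trans by blast
          from isolated_modification_subset[OF iso[rule_format] this] w(2)[of i]
          have "w i \<in> U n {y (e i)} \<inter> h n (y (e i))"
            unfolding g_def by (rule subsetD)
          then show ?thesis
            using singleton_expansion_subset_tail[OF U X ye iso[rule_format] no that] by auto
        qed
        then have "w ` {n..} \<subseteq> U n (X closure_of ((\<lambda>n. y (e n)) ` {n..}))" for n
          by auto
        then have "z \<in> X closure_of (U n (X closure_of ((\<lambda>n. y (e n)) ` {n..})))" for n
          using z unfolding cluster_point_of_seq_iff_closure_of_tails
          by (meson closure_of_mono subsetD)
        then have "z \<in> (\<Inter>n. X closure_of (U n (X closure_of ((\<lambda>n. y (e n)) ` {n..}))))"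
          by simp
        then show False
          using closure_expansion_INT_empty[OF clU tails_family[OF X ye iso[rule_format] no]]
          by (metis empty_iff)
      qed
    qed
    then show ?thesis using cluster_point_of_seq_reindex e by metis
  qed
  with g show ?thesis unfolding wN_space_def by blast
qed

section \<open>Sufficient conditions for the q-property\<close>

lemma countably_compactin_imp_cluster_point:
  assumes S: "countably_compactin X S" and y: "range y \<subseteq> S"
  shows "\<exists>z. cluster_point_of_seq X y z"
proof (rule ccontr)
  assume no: "\<nexists>z. cluster_point_of_seq X y z"
  \<comment> \<open>Without a cluster point these open sets cover \<open>S\<close>. If finitely many
    of them, with indices at most \<open>m\<close>, suffice, then \<open>y m\<close> lies in some
    \<open>V i\<close> with \<open>i \<le> m\<close>, although \<open>V i\<close> omits every term
    from index \<open>i\<close> on.\<close>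
  define V where "V n = topspace X - X closure_of (y ` {n..})" for n
  have ytop: "range y \<subseteq> topspace X"
    using S y unfolding countably_compactin_def by blast
  have "S \<subseteq> topspace X"
    using S unfolding countably_compactin_def by simp
  moreover have "\<exists>n. z \<notin> X closure_of (y ` {n..})" for z
    using no unfolding cluster_point_of_seq_iff_closure_of_tails by simp
  ultimately have "S \<subseteq> \<Union>(range V)"
    unfolding V_def by blast
  moreover have "countable (range V)" "\<forall>U\<in>range V. openin X U"
    by (auto simp: V_def)
  ultimately obtain \<F> where "finite \<F>" "\<F> \<subseteq> range V" and S_sub: "S \<subseteq> \<Union>\<F>"
    using S unfolding countably_compactin_def by metis
  then obtain I where "finite I" and \<F>: "\<F> = V ` I"
    by (meson finite_subset_image)
  then obtain m where m: "\<And>i. i \<in> I \<Longrightarrow> i \<le> m"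
    by (meson finite_nat_set_iff_bounded_le)
  obtain i where i: "i \<in> I" "y m \<in> V i"
    using S_sub y \<F> by blast
  have "y ` {i..} \<subseteq> X closure_of (y ` {i..})"
    using ytop by (intro closure_of_subset) blast
  then show False
    using i m[OF i(1)] unfolding V_def by auto
qed

lemma countably_compact_nhds_imp_q:
  assumes "\<And>x. x \<in> topspace X \<Longrightarrow> \<exists>G S. openin X G \<and> x \<in> G \<and> G \<subseteq> S \<and> countably_compactin X S"
  shows "q_space X"
proof -
  obtain G S where G: "\<And>x. x \<in> topspace X \<Longrightarrow>
      openin X (G x) \<and> x \<in> G x \<and> G x \<subseteq> S x \<and> countably_compactin X (S x)"
    using assms by metis
  \<comment> \<open>An assignment independent of \<open>n\<close> is enough: every sequence in
    \<open>G x\<close> lies in the countably compact set \<open>S x\<close>.\<close>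
  then have "open_nhd_assignment X (\<lambda>n. G)"
    unfolding open_nhd_assignment_def by blast
  moreover have "\<exists>z. cluster_point_of_seq X y z"
    if "x \<in> topspace X" "\<forall>n. y n \<in> G x" for x y
    using countably_compactin_imp_cluster_point[of X "S x" y] G that by blast
  ultimately show ?thesis unfolding q_space_def by metis
qed

lemma locally_countably_compact_imp_q:
  assumes "locally_countably_compact_space X"
  shows "q_space X"
proof (rule countably_compact_nhds_imp_q)
  fix x assume "x \<in> topspace X"
  then obtain N where N: "N \<subseteq> topspace X" "x \<in> X interior_of N"
      "countably_compactin X (X closure_of N)"
    using assms unfolding locally_countably_compact_space_def by blast
  moreover have "X interior_of N \<subseteq> X closure_of N"
    using N(1) interior_of_subset closure_of_subset by (metis order_trans)
  ultimately show "\<exists>G S. openin X G \<and> x \<in> G \<and> G \<subseteq> S \<and> countably_compactin X S"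
    using openin_interior_of by blast
qed

lemma compactin_imp_countably_compactin:
  "compactin X S \<Longrightarrow> countably_compactin X S"
  unfolding compactin_def countably_compactin_def by blast

lemma locally_compact_imp_q:
  assumes "locally_compact_space X"
  shows "q_space X"
proof (rule countably_compact_nhds_imp_q)
  fix x assume "x \<in> topspace X"
  then show "\<exists>G S. openin X G \<and> x \<in> G \<and> G \<subseteq> S \<and> countably_compactin X S"
    using assms compactin_imp_countably_compactin unfolding locally_compact_space_def by meson
qed

lemma first_countable_imp_q:
  fixes X :: "'a topology"
  assumes "first_countable X"
  shows "q_space X"
proof -
  have "\<exists>b :: nat \<Rightarrow> 'a set. (\<forall>n. openin X (b n) \<and> x \<in> b n) \<and>
          (\<forall>V. openin X V \<and> x \<in> V \<longrightarrow> (\<exists>n. b n \<subseteq> V))"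
    if x: "x \<in> topspace X" for x
  proof -
    obtain B where B: "countable B" "\<And>V. V \<in> B \<Longrightarrow> openin X V"
        "\<And>V. openin X V \<Longrightarrow> x \<in> V \<Longrightarrow> \<exists>W\<in>B. x \<in> W \<and> W \<subseteq> V"
      using assms x unfolding first_countable_def by metis
    \<comment> \<open>Members of \<open>B\<close> may miss \<open>x\<close>; those containing it
      form a countable local base, nonempty and hence enumerable by
      \<open>from_nat_into\<close>.\<close>
    let ?B = "{W\<in>B. x \<in> W}"
    have ne: "?B \<noteq> {}" using B(3)[of "topspace X"] x by auto
    have r: "range (from_nat_into ?B) = ?B"
      using ne B(1) by simp
    have "openin X (from_nat_into ?B n) \<and> x \<in> from_nat_into ?B n" for n
      using from_nat_into[OF ne, of n] B(2) by blast
    moreover have "\<exists>n. from_nat_into ?B n \<subseteq> V" if V: "openin X V" "x \<in> V" for V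
    proof -
      obtain W where "W \<in> ?B" and W: "W \<subseteq> V" using B(3)[OF V] by blast
      then have "W \<in> range (from_nat_into ?B)" unfolding r by simp
      then obtain n where "W = from_nat_into ?B n" by (rule imageE)
      with W show ?thesis by (intro exI[of _ n]) simp
    qed
    ultimately show ?thesis by blast
  qed
  then obtain b :: "'a \<Rightarrow> nat \<Rightarrow> 'a set"
    where b: "\<And>x n. x \<in> topspace X \<Longrightarrow> openin X (b x n) \<and> x \<in> b x n"
      and base: "\<And>x V. \<lbrakk>x \<in> topspace X; openin X V; x \<in> V\<rbrakk> \<Longrightarrow> \<exists>n. b x n \<subseteq> V"
    by metis
  \<comment> \<open>Finite intersections make the local base decreasing, so that \<open>y n\<close>
    lies in \<open>b x k\<close> for all \<open>n \<ge> k\<close> and \<open>x\<close> itself is a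
    cluster point.\<close>
  have "open_nhd_assignment X (\<lambda>n x. \<Inter>i\<le>n. b x i)"
    using b unfolding open_nhd_assignment_def by (auto intro!: openin_INT2)
  moreover have "cluster_point_of_seq X y x"
    if x: "x \<in> topspace X" and y: "\<forall>n. y n \<in> (\<Inter>i\<le>n. b x i)" for x y
    unfolding cluster_point_of_seq_def frequently_sequentially
  proof (intro conjI allI impI x)
    fix V m assume V: "openin X V \<and> x \<in> V"
    then obtain k where "b x k \<subseteq> V" using base x by blast
    moreover have "y (max m k) \<in> b x k" using y by auto
    ultimately show "\<exists>n\<ge>m. y n \<in> V" by (meson max.cobounded1 subsetD)
  qed
  ultimately show ?thesis unfolding q_space_def by blast
qed

theorem theorem10:
  fixes X :: "'a topology"
  assumes "regular_space X" and "t1_space X"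
  shows "((nMCM_space X \<longleftrightarrow> MCM_space X) \<and> (MCM_space X \<longleftrightarrow> beta_space X)) \<and>
         (q_space X \<or> locally_countably_compact_space X \<longrightarrow>
            (nMCP_space X \<longleftrightarrow> MCP_space X) \<and> (MCP_space X \<longleftrightarrow> wN_space X)) \<and>
         (nMCP_space X \<and> (first_countable X \<or> locally_compact_space X) \<longrightarrow> MCP_space X)"
  \<comment> \<open>Two cycles of implications close: beta, MCM, nMCM, beta; and, given the
    q-property, wN, MCP, nMCP, wN.\<close>
  using MCM_imp_nMCM[of X] MCP_imp_nMCP[of X] beta_imp_MCM[of X] wN_imp_MCP[of X]
    nMCM_imp_beta[OF assms(2)] nMCP_q_imp_wN[OF assms(2)]
    locally_countably_compact_imp_q[of X] first_countable_imp_q[of X] locally_compact_imp_q[of X]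
  by argo

end
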